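(* Let $\mathcal G=(\mathcal V,\mathcal E)$ be a finite directed graph with $n=|\mathcal V|>2$ nodes in which every node $i$ has out-degree $n_i=|\{h\in\mathcal V:(i,h)\in\mathcal E\}|\ge1$, let $m\in(0,1)$, and let $x^\star_{\rm pgr}$ be the PageRank vector of $\mathcal G$ with parameter $m$. Let $\{\theta(k)\}_{k\in\mathbb Z_{\ge0}}$ be i.i.d. and uniformly distributed over $\mathcal E$. Set $$r=\frac{m}{m-|\mathcal E|m+|\mathcal E|},$$ let $x(0)\in\mathbb R^{\mathcal V}$ be a stochastic vector and, for $k\ge0$, if $\theta(k)=(i,j)$, let $$x(k+1)=(1-r)\Big(I+\frac1{n_i}\big(e_je_i^\top-e_ie_i^\top\big)\Big)x(k)+\frac rn\mathbf 1,$$ and $$\overline x_\ell(k+1)=\frac{k\,\overline x_\ell(k)+x_\ell(k+1)}{k+1}\qquad\text{for all }\ell\in\mathcal V.$$ Then $\lim_{k\to\infty}\overline x(k)=x^\star_{\rm pgr}$ almost surely.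
   Context: $\mathbf 1$ is the all-ones vector and $e_i$ the $i$-th canonical basis vector of $\mathbb R^{\mathcal V}$. A vector is stochastic if its entries are nonnegative and sum to $1$. Let $A\in\mathbb R^{\mathcal V\times\mathcal V}$ be the column-stochastic matrix with $A_{ij}=1/n_j$ if $(j,i)\in\mathcal E$ and $A_{ij}=0$ otherwise, and let $M=(1-m)A+\frac mn\mathbf 1\mathbf 1^\top$. The PageRank of $\mathcal G$ is the vector $x^\star_{\rm pgr}$ such that $Mx^\star_{\rm pgr}=x^\star_{\rm pgr}$ and $\sum_i(x^\star_{\rm pgr})_i=1$. (The value $\overline x(0)$ is irrelevant.) *)

theory Defs
  imports "HOL-Probability.Probability"
begin

text \<open>
  A directed graph is given by its edge set \<open>E\<close> on the vertex set \<open>UNIV :: 'v set\<close> of a finite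
  type; self-loops are allowed. Entry \<open>B $ i $ j\<close> of a matrix is the one in row \<open>i\<close>, column \<open>j\<close>.
\<close>

definition out_degree :: "('v \<times> 'v) set \<Rightarrow> 'v \<Rightarrow> nat" where
  "out_degree E i = card {h. (i, h) \<in> E}"

definition outer_product :: "real ^ 'v \<Rightarrow> real ^ 'v \<Rightarrow> real ^ 'v ^ 'v" where
  "outer_product u v = (\<chi> i j. u $ i * v $ j)"

definition stochastic_vector :: "real ^ 'v \<Rightarrow> bool" where
  "stochastic_vector x \<longleftrightarrow> (\<forall>i. 0 \<le> x $ i) \<and> (\<Sum>i\<in>UNIV. x $ i) = 1"

definition link_matrix :: "('v \<times> 'v) set \<Rightarrow> real ^ 'v ^ 'v" where
  "link_matrix E = (\<chi> i j. if (j, i) \<in> E then 1 / real (out_degree E j) else 0)"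

definition pagerank_matrix :: "('v::finite \<times> 'v) set \<Rightarrow> real \<Rightarrow> real ^ 'v ^ 'v" where
  "pagerank_matrix E m =
     (1 - m) *\<^sub>R link_matrix E + (m / real CARD('v)) *\<^sub>R outer_product 1 1"

definition is_pagerank :: "('v::finite \<times> 'v) set \<Rightarrow> real \<Rightarrow> real ^ 'v \<Rightarrow> bool" where
  "is_pagerank E m x \<longleftrightarrow> pagerank_matrix E m *v x = x \<and> (\<Sum>i\<in>UNIV. x $ i) = 1"

definition gossip_matrix :: "('v::finite \<times> 'v) set \<Rightarrow> 'v \<Rightarrow> 'v \<Rightarrow> real ^ 'v ^ 'v" where
  "gossip_matrix E i j =
     mat 1 + (1 / real (out_degree E i)) *\<^sub>R
       (outer_product (axis j 1) (axis i 1) - outer_product (axis i 1) (axis i 1))"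

definition gossip_step ::
  "('v::finite \<times> 'v) set \<Rightarrow> real \<Rightarrow> 'v \<times> 'v \<Rightarrow> real ^ 'v \<Rightarrow> real ^ 'v" where
  "gossip_step E r = (\<lambda>(i, j) x.
     (1 - r) *\<^sub>R (gossip_matrix E i j *v x) + (r / real CARD('v)) *\<^sub>R 1)"

end

theory Submission
  imports Defs "HOL-Library.Discrete_Functions"
begin

text \<open>
  Let \<open>f\<close> be the expected update map. It is affine, its linear part \<open>B\<close> contracts the \<open>l1\<close> norm by
  the factor \<open>1 - r\<close> because gossip matrices are column-stochastic, and the choice of \<open>r\<close> makes
  PageRank its fixed point \<open>p\<close>. Averaging \<open>x(k+1) - p = B (x(k) - p) + \<xi>(k)\<close> over \<open>k < n\<close> gives
  \<open>D = B D + O(1/n) + S\<close>, where \<open>D\<close> is the average of \<open>x(k+1) - p\<close> and \<open>S\<close> that of \<open>\<xi>(k)\<close>;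
  hence \<open>r |D| \<le> 2/n + |S|\<close>. The noise \<open>\<xi>\<close> is bounded and pairwise orthogonal, since \<open>\<theta>(k)\<close> is
  independent of the past, so \<open>S\<close> tends to \<open>0\<close> almost surely by the strong law for bounded
  orthogonal variables: a second moment bound along the squares, with the gaps filled by boundedness.
\<close>

section \<open>The strong law for bounded orthogonal variables\<close>

text \<open>If \<open>q\<^sup>2\<close> is the largest square up to \<open>n\<close>, at most
  \<open>2 * q\<close> terms lie beyond it. Each is at most \<open>C\<close> in absolute value, so
  relative to \<open>q\<^sup>2\<close> they add at most \<open>2 * C / q\<close>, which vanishes as
  \<open>n\<close> grows.\<close>

lemma tendsto_average_if_squares:
  fixes a :: "nat \<Rightarrow> real"
  assumes bound: "\<And>k. \<bar>a k\<bar> \<le> C"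
    and squares: "(\<lambda>k. (\<Sum>i<(Suc k)\<^sup>2. a i) / real ((Suc k)\<^sup>2)) \<longlonglongrightarrow> 0"
  shows "(\<lambda>n. (\<Sum>i<n. a i) / real n) \<longlonglongrightarrow> 0"
proof -
  define S where "S n = (\<Sum>i<n. a i)" for n
  have C: "0 \<le> C" using bound[of 0] by linarith
  have floor_sqrt_top: "filterlim floor_sqrt at_top sequentially"
    unfolding filterlim_at_top
  proof
    fix Z
    show "\<forall>\<^sub>F n in sequentially. Z \<le> floor_sqrt n"
      using eventually_ge_at_top[of "Z\<^sup>2"]
      by eventually_elim (metis floor_sqrt_inverse_power2 mono_floor_sqrt')
  qed
  have "(\<lambda>k. S (k\<^sup>2) / real (k\<^sup>2)) \<longlonglongrightarrow> 0"
    using squares unfolding S_def[symmetric]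
    by (rule LIMSEQ_imp_Suc[where f = "\<lambda>k. S (k\<^sup>2) / real (k\<^sup>2)"])
  then have "(\<lambda>k. \<bar>S (k\<^sup>2) / real (k\<^sup>2)\<bar> + 2 * C / real k) \<longlonglongrightarrow> \<bar>0\<bar> + 0"
    by (intro tendsto_add tendsto_rabs lim_const_over_n)
  then have lim: "(\<lambda>n. \<bar>S ((floor_sqrt n)\<^sup>2) / real ((floor_sqrt n)\<^sup>2)\<bar> + 2 * C / real (floor_sqrt n)) \<longlonglongrightarrow> 0"
    using filterlim_compose[OF _ floor_sqrt_top] by fastforce
  have "\<forall>\<^sub>F n in sequentially. norm (S n / real n) \<le>
     \<bar>S ((floor_sqrt n)\<^sup>2) / real ((floor_sqrt n)\<^sup>2)\<bar> + 2 * C / real (floor_sqrt n)"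
    using eventually_gt_at_top[of 0]
  proof eventually_elim
    case (elim n)
    define q where "q = floor_sqrt n"
    have q0: "q > 0" using elim by (simp add: q_def)
    have q1: "q\<^sup>2 \<le> n" by (simp add: q_def)
    \<comment> \<open>The strict inequality matters: it turns \<open>q\<^sup>2 + 2 * q + 1\<close>
      into the bound \<open>q\<^sup>2 + 2 * q\<close>, so the remainder is linear in
      \<open>q\<close>.\<close>
    have "n < (Suc q)\<^sup>2" by (simp add: q_def Suc_floor_sqrt_power2_gt)
    then have q2: "n \<le> q\<^sup>2 + 2 * q" by (simp add: power2_eq_square)
    have "S n = S (q\<^sup>2) + (\<Sum>i = q\<^sup>2..<n. a i)"
      unfolding S_def lessThan_atLeast0 using q1 by (simp add: sum.atLeastLessThan_concat)
    moreover have "\<bar>\<Sum>i = q\<^sup>2..<n. a i\<bar> \<le> (\<Sum>i = q\<^sup>2..<n. C)"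
      by (intro order_trans[OF sum_abs] sum_mono bound)
    moreover have "(\<Sum>i = q\<^sup>2..<n. C) \<le> 2 * real q * C"
    proof -
      have "real (n - q\<^sup>2) \<le> 2 * real q" using q2 by linarith
      then show ?thesis using C by (simp add: mult_right_mono)
    qed
    ultimately have "\<bar>S n\<bar> \<le> \<bar>S (q\<^sup>2)\<bar> + 2 * real q * C" by linarith
    then have "\<bar>S n\<bar> / real n \<le> (\<bar>S (q\<^sup>2)\<bar> + 2 * real q * C) / real n"
      by (simp add: divide_right_mono)
    also have "\<dots> \<le> (\<bar>S (q\<^sup>2)\<bar> + 2 * real q * C) / real (q\<^sup>2)"
      using q1 q0 elim C by (intro divide_left_mono) (auto simp del: of_nat_power)
    also have "\<dots> = \<bar>S (q\<^sup>2) / real (q\<^sup>2)\<bar> + 2 * C / real q"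
      using q0 by (simp add: field_simps power2_eq_square)
    finally show ?case by (simp add: q_def)
  qed
  then show ?thesis
    using lim unfolding S_def by (rule Lim_null_comparison)
qed

text \<open>Orthogonality makes the second moment of the partial sums grow only linearly in
  \<open>n\<close>, so that of the average is at most \<open>C\<^sup>2 / n\<close>. This is summable
  along the squares, which forces almost sure convergence there; boundedness handles all other
  \<open>n\<close>.\<close>

lemma (in prob_space) AE_average_tendsto_0:
  fixes Y :: "nat \<Rightarrow> 'a \<Rightarrow> real"
  assumes meas [measurable]: "\<And>k. Y k \<in> borel_measurable M"
    and bound: "\<And>k \<omega>. \<omega> \<in> space M \<Longrightarrow> \<bar>Y k \<omega>\<bar> \<le> C"
    and orth: "\<And>i j. i < j \<Longrightarrow> expectation (\<lambda>\<omega>. Y i \<omega> * Y j \<omega>) = 0"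
  shows "AE \<omega> in M. (\<lambda>n. (\<Sum>k<n. Y k \<omega>) / real n) \<longlonglongrightarrow> 0"
proof -
  define S where "S n \<omega> = (\<Sum>k<n. Y k \<omega>)" for n \<omega>
  have [measurable]: "S n \<in> borel_measurable M" for n unfolding S_def by measurable
  obtain \<omega>0 where "\<omega>0 \<in> space M" using not_empty by blast
  then have C: "0 \<le> C" using bound[of \<omega>0 0] by linarith
  have S_bound: "\<bar>S n \<omega>\<bar> \<le> real n * C" if "\<omega> \<in> space M" for n \<omega>
  proof -
    have "\<bar>S n \<omega>\<bar> \<le> (\<Sum>k<n. C)"
      unfolding S_def by (intro order_trans[OF sum_abs] sum_mono bound that)
    then show ?thesis by simp
  qed
  have int_YY: "integrable M (\<lambda>\<omega>. Y i \<omega> * Y j \<omega>)" for i j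
    by (rule integrable_const_bound[where B = "C * C"])
       (use bound C in \<open>auto intro!: AE_I2 mult_mono simp: abs_mult\<close>)
  have int_SY: "integrable M (\<lambda>\<omega>. S n \<omega> * Y j \<omega>)" for n j
    unfolding S_def sum_distrib_right by (intro Bochner_Integration.integrable_sum int_YY)
  have int_S2: "integrable M (\<lambda>\<omega>. (S n \<omega>)\<^sup>2)" for n
    by (rule integrable_const_bound[where B = "(real n * C)\<^sup>2"])
       (use S_bound in \<open>auto intro!: AE_I2 simp: abs_le_square_iff[symmetric] C\<close>)
  have second_moment: "expectation (\<lambda>\<omega>. (S n \<omega>)\<^sup>2) \<le> real n * C\<^sup>2" for n
  proof (induction n)
    case 0
    then show ?case by (simp add: S_def)
  next
    case (Suc n)
    have "expectation (\<lambda>\<omega>. S n \<omega> * Y n \<omega>) = (\<Sum>k<n. expectation (\<lambda>\<omega>. Y k \<omega> * Y n \<omega>))"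
      unfolding S_def sum_distrib_right
      by (intro Bochner_Integration.integral_sum int_YY)
    also have "\<dots> = 0" by (simp add: orth)
    finally have cross: "expectation (\<lambda>\<omega>. S n \<omega> * Y n \<omega>) = 0" .
    have "expectation (\<lambda>\<omega>. Y n \<omega> * Y n \<omega>) \<le> expectation (\<lambda>_. C\<^sup>2)"
    proof (rule integral_mono[OF int_YY])
      fix \<omega> assume "\<omega> \<in> space M"
      then show "Y n \<omega> * Y n \<omega> \<le> C\<^sup>2"
        using bound[of \<omega> n] C by (simp add: power2_eq_square[symmetric] abs_le_square_iff[symmetric])
    qed simp
    then have diag: "expectation (\<lambda>\<omega>. Y n \<omega> * Y n \<omega>) \<le> C\<^sup>2" by (simp add: prob_space)
    have "(S (Suc n) \<omega>)\<^sup>2 = (S n \<omega>)\<^sup>2 + 2 * (S n \<omega> * Y n \<omega>) + Y n \<omega> * Y n \<omega>" for \<omega>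
      by (simp add: S_def power2_eq_square algebra_simps)
    then have "expectation (\<lambda>\<omega>. (S (Suc n) \<omega>)\<^sup>2) =
        expectation (\<lambda>\<omega>. (S n \<omega>)\<^sup>2) + 2 * expectation (\<lambda>\<omega>. S n \<omega> * Y n \<omega>)
          + expectation (\<lambda>\<omega>. Y n \<omega> * Y n \<omega>)"
      using int_S2[of n] int_SY[of n n] int_YY[of n n] by simp
    with Suc cross diag show ?case by (simp add: algebra_simps)
  qed
  \<comment> \<open>Squared averages along the squares, started at \<open>Suc k\<close> to avoid
    division by zero.\<close>
  define Z where "Z k \<omega> = (S ((Suc k)\<^sup>2) \<omega> / real ((Suc k)\<^sup>2))\<^sup>2" for k \<omega>
  have [measurable]: "Z k \<in> borel_measurable M" for k unfolding Z_def by measurable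
  have int_Z: "integrable M (Z k)" for k
    using int_S2[of "(Suc k)\<^sup>2"] by (simp add: Z_def[abs_def] power_divide)
  have exp_Z: "expectation (Z k) \<le> C\<^sup>2 * (1 / (real (Suc k))\<^sup>2)" for k
  proof -
    have "expectation (Z k) = expectation (\<lambda>\<omega>. (S ((Suc k)\<^sup>2) \<omega>)\<^sup>2) / (real ((Suc k)\<^sup>2))\<^sup>2"
      by (simp add: Z_def[abs_def] power_divide)
    also have "\<dots> \<le> (real ((Suc k)\<^sup>2) * C\<^sup>2) / (real ((Suc k)\<^sup>2))\<^sup>2"
      by (intro divide_right_mono second_moment) simp
    also have "\<dots> = C\<^sup>2 * (1 / (real (Suc k))\<^sup>2)"
      unfolding of_nat_power by (simp add: power2_eq_square del: of_nat_Suc)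
    finally show ?thesis .
  qed
  have summ: "summable (\<lambda>k. C\<^sup>2 * (1 / (real (Suc k))\<^sup>2))"
    using inverse_power_summable[of 2, where 'a = real]
    by (intro summable_mult, subst summable_Suc_iff[where f = "\<lambda>n. 1 / (real n)\<^sup>2"])
      (simp add: inverse_eq_divide)
  \<comment> \<open>Monotone convergence: the series of the \<open>Z k\<close> has finite
    expectation, hence is finite almost surely, and then its terms tend to \<open>0\<close>.\<close>
  have "(\<integral>\<^sup>+\<omega>. (\<Sum>k. ennreal (Z k \<omega>)) \<partial>M) = (\<Sum>k. \<integral>\<^sup>+\<omega>. ennreal (Z k \<omega>) \<partial>M)"
    by (rule nn_integral_suminf) measurable
  also have "\<dots> = (\<Sum>k. ennreal (expectation (Z k)))"
    by (intro suminf_cong nn_integral_eq_integral int_Z) (simp add: Z_def)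
  also have "\<dots> \<le> (\<Sum>k. ennreal (C\<^sup>2 * (1 / (real (Suc k))\<^sup>2)))"
    by (intro suminf_le ennreal_leI exp_Z) auto
  also have "\<dots> < \<infinity>"
    by (subst suminf_ennreal_eq[OF _ summable_sums[OF summ]]) simp_all
  finally have "(\<integral>\<^sup>+\<omega>. (\<Sum>k. ennreal (Z k \<omega>)) \<partial>M) \<noteq> \<infinity>" by simp
  then have "AE \<omega> in M. (\<Sum>k. ennreal (Z k \<omega>)) \<noteq> \<infinity>"
    by (intro nn_integral_PInf_AE) measurable
  then show ?thesis
  proof (rule AE_mp, intro AE_I2 impI)
    fix \<omega> assume \<omega>: "\<omega> \<in> space M" and fin: "(\<Sum>k. ennreal (Z k \<omega>)) \<noteq> \<infinity>"
    have "summable (\<lambda>k. Z k \<omega>)"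
      using fin by (intro summable_suminf_not_top) (auto simp: Z_def)
    then have "(\<lambda>k. sqrt (Z k \<omega>)) \<longlonglongrightarrow> sqrt 0"
      by (intro tendsto_real_sqrt summable_LIMSEQ_zero)
    then have "(\<lambda>k. S ((Suc k)\<^sup>2) \<omega> / real ((Suc k)\<^sup>2)) \<longlonglongrightarrow> 0"
      unfolding Z_def real_sqrt_abs real_sqrt_zero by (rule tendsto_rabs_zero_cancel)
    then show "(\<lambda>n. (\<Sum>k<n. Y k \<omega>) / real n) \<longlonglongrightarrow> 0"
      using bound[OF \<omega>] unfolding S_def by (intro tendsto_average_if_squares[where C = C])
  qed
qed

section \<open>The \<open>l1\<close> norm under gossip updates\<close>

text \<open>Column-stochastic matrices never increase this norm, whereas they can increase the
  Euclidean one, which is \<open>norm\<close> on this type.\<close>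

definition l1_norm :: "real ^ 'v::finite \<Rightarrow> real" where
  "l1_norm x = (\<Sum>i\<in>UNIV. \<bar>x $ i\<bar>)"

lemma l1_norm_nonneg: "0 \<le> l1_norm x"
  by (simp add: l1_norm_def sum_nonneg)

lemma l1_norm_triangle: "l1_norm (x + y) \<le> l1_norm x + l1_norm y"
  unfolding l1_norm_def sum.distrib[symmetric] by (intro sum_mono) simp

lemma l1_norm_scaleR: "l1_norm (c *\<^sub>R x) = \<bar>c\<bar> * l1_norm x"
  by (simp add: l1_norm_def abs_mult sum_distrib_left)

lemma l1_norm_zero [simp]: "l1_norm 0 = 0"
  by (simp add: l1_norm_def)

lemma l1_norm_sum: "l1_norm (\<Sum>k\<in>K. f k) \<le> (\<Sum>k\<in>K. l1_norm (f k))"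
  by (induction K rule: infinite_finite_induct)
     (auto intro: order_trans[OF l1_norm_triangle])

lemma component_le_l1_norm: "\<bar>x $ i\<bar> \<le> l1_norm x"
  unfolding l1_norm_def by (rule member_le_sum) auto

text \<open>The matrix moves the fraction \<open>1 / out_degree E i\<close> of the value at
  \<open>i\<close> to \<open>j\<close>. For a self-loop the two corrections cancel.\<close>

lemma gossip_matrix_mult_component:
  "(gossip_matrix E i j *v x) $ l =
     x $ l + ((if l = j then x $ i else 0) - (if l = i then x $ i else 0)) / real (out_degree E i)"
proof -
  have "(gossip_matrix E i j *v x) $ l =
      (\<Sum>k\<in>UNIV. (if k = l then x $ k else 0) +
         (if k = i then (of_bool (l = j) - of_bool (l = i)) * x $ k / real (out_degree E i) else 0))"
    unfolding matrix_vector_mult_def gossip_matrix_def outer_product_def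
    by (auto intro!: sum.cong simp: mat_def axis_def algebra_simps diff_divide_distrib)
  also have "\<dots> = x $ l + (of_bool (l = j) - of_bool (l = i)) * x $ i / real (out_degree E i)"
    by (simp add: sum.distrib)
  finally show ?thesis by auto
qed

text \<open>What entry \<open>j\<close> gains in absolute value is at most
  \<open>\<bar>x $ i\<bar> / n\<close>, and entry \<open>i\<close> loses exactly that much because
  \<open>1 - 1 / n\<close> is nonnegative. Pairs outside \<open>E\<close> are covered as well, so
  trajectories are bounded at every sample point and not just almost surely.\<close>

lemma l1_norm_gossip_matrix_mult_le:
  assumes "out_degree E i \<ge> 1"
  shows "l1_norm (gossip_matrix E i j *v x) \<le> l1_norm x"
proof -
  define n where "n = real (out_degree E i)"
  have n: "n \<ge> 1" using assms by (simp add: n_def)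
  have "l1_norm (gossip_matrix E i j *v x) \<le>
      (\<Sum>l\<in>UNIV. \<bar>x $ l\<bar> + ((if l = j then \<bar>x $ i\<bar> else 0) - (if l = i then \<bar>x $ i\<bar> else 0)) / n)"
    unfolding l1_norm_def
  proof (rule sum_mono)
    fix l
    have "\<bar>x $ i - x $ i / n\<bar> \<le> \<bar>x $ i\<bar> - \<bar>x $ i\<bar> / n"
    proof -
      have "x $ i - x $ i / n = x $ i * (1 - 1 / n)" by (simp add: algebra_simps)
      moreover have "0 \<le> 1 - 1 / n" using n by simp
      ultimately have "\<bar>x $ i - x $ i / n\<bar> = \<bar>x $ i\<bar> * (1 - 1 / n)" by (simp add: abs_mult)
      then show ?thesis by (simp add: algebra_simps)
    qed
    moreover have "\<bar>x $ j + x $ i / n\<bar> \<le> \<bar>x $ j\<bar> + \<bar>x $ i\<bar> / n"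
      using n abs_triangle_ineq[of "x $ j" "x $ i / n"] by simp
    ultimately show "\<bar>(gossip_matrix E i j *v x) $ l\<bar> \<le>
        \<bar>x $ l\<bar> + ((if l = j then \<bar>x $ i\<bar> else 0) - (if l = i then \<bar>x $ i\<bar> else 0)) / n"
      unfolding gossip_matrix_mult_component n_def[symmetric] by auto
  qed
  also have "\<dots> = l1_norm x"
    by (simp add: l1_norm_def sum.distrib sum_subtractf sum_divide_distrib[symmetric])
  finally show ?thesis .
qed

section \<open>The expected update and its fixed point\<close>

text \<open>The map \<open>f\<close> of the overview: the conditional expectation of the next state,
  given the current one, for an edge drawn uniformly from \<open>E\<close>.\<close>

definition mean_step :: "('v::finite \<times> 'v) set \<Rightarrow> real \<Rightarrow> real ^ 'v \<Rightarrow> real ^ 'v" where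
  "mean_step E r x = (1 / real (card E)) *\<^sub>R (\<Sum>e\<in>E. gossip_step E r e x)"

lemma gossip_step_diff:
  "gossip_step E r e x - gossip_step E r e y =
     (1 - r) *\<^sub>R (gossip_matrix E (fst e) (snd e) *v (x - y))"
  by (simp add: gossip_step_def split_beta matrix_vector_mult_diff_distrib scaleR_diff_right)

text \<open>The step is a convex combination, with weights \<open>1 - r\<close> and
  \<open>r\<close>, of a gossip image and the uniform vector, both in the unit \<open>l1\<close>
  ball.\<close>

lemma l1_norm_gossip_step_le:
  assumes "\<And>i. out_degree E i \<ge> 1" "0 \<le> r" "r \<le> 1" "l1_norm x \<le> 1"
  shows "l1_norm (gossip_step E r e x) \<le> 1"
proof -
  have "l1_norm ((1::real ^ 'a)) = real CARD('a)" by (simp add: l1_norm_def)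
  then have "l1_norm ((r / real CARD('a)) *\<^sub>R (1::real ^ 'a)) = r"
    using assms by (simp add: l1_norm_scaleR)
  moreover have "l1_norm ((1 - r) *\<^sub>R (gossip_matrix E (fst e) (snd e) *v x)) \<le> (1 - r) * 1"
    unfolding l1_norm_scaleR using assms
    by (intro mult_mono order_trans[OF l1_norm_gossip_matrix_mult_le]) (auto simp: l1_norm_nonneg)
  ultimately show ?thesis
    using l1_norm_triangle[of "(1 - r) *\<^sub>R (gossip_matrix E (fst e) (snd e) *v x)"
      "(r / real CARD('a)) *\<^sub>R (1::real ^ 'a)"]
    by (simp add: gossip_step_def split_beta)
qed

lemma l1_norm_mean_step_le:
  assumes "\<And>i. out_degree E i \<ge> 1" "0 \<le> r" "r \<le> 1" "E \<noteq> {}" "l1_norm x \<le> 1"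
  shows "l1_norm (mean_step E r x) \<le> 1"
proof -
  have "l1_norm (\<Sum>e\<in>E. gossip_step E r e x) \<le> (\<Sum>e\<in>E. 1)"
    by (intro order_trans[OF l1_norm_sum] sum_mono l1_norm_gossip_step_le assms)
  then show ?thesis
    using assms(4) by (simp add: mean_step_def l1_norm_scaleR divide_le_eq card_gt_0_iff)
qed

text \<open>Over its \<open>n_i\<close> outgoing edges, node \<open>i\<close> sends away
  \<open>n_i\<close> times the fraction \<open>1 / n_i\<close>, that is, its whole value once. What
  arrives elsewhere is the corresponding entry of \<open>link_matrix E *v x\<close>.\<close>

lemma sum_gossip_matrix_mult:
  assumes deg: "\<And>i. out_degree E i \<ge> 1"
  shows "(\<Sum>(i, j)\<in>E. gossip_matrix E i j *v x) = real (card E) *\<^sub>R x + (link_matrix E *v x - x)"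
proof (subst vec_eq_iff, intro allI)
  fix l
  let ?n = "\<lambda>i. real (out_degree E i)"
  \<comment> \<open>Edges are grouped by their tail, so that the inner sums run over
    out-neighbours.\<close>
  have E: "E = Sigma UNIV (\<lambda>i. {j. (i, j) \<in> E})" by auto
  have "(\<Sum>(i, j)\<in>E. (if l = j then x $ i else 0) / ?n i) = 
      (\<Sum>i\<in>UNIV. \<Sum>j | (i, j) \<in> E. (if l = j then x $ i else 0) / ?n i)"
    by (subst (1) E, subst sum.Sigma) auto
  also have "\<dots> = (link_matrix E *v x) $ l"
    unfolding matrix_vector_mult_def link_matrix_def
    by (auto intro!: sum.cong simp: if_distrib[of "\<lambda>t. t / _"] cong: if_cong)
  finally have inflow: "(\<Sum>(i, j)\<in>E. (if l = j then x $ i else 0) / ?n i) = (link_matrix E *v x) $ l" .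
  have "(\<Sum>(i, j)\<in>E. (if l = i then x $ i else 0) / ?n i) = 
      (\<Sum>i\<in>UNIV. \<Sum>j | (i, j) \<in> E. (if l = i then x $ i else 0) / ?n i)"
    by (subst (1) E, subst sum.Sigma) auto
  also have "\<dots> = (\<Sum>i\<in>UNIV. if l = i then x $ i else 0)"
  proof (intro sum.cong refl)
    fix i
    show "(\<Sum>j | (i, j) \<in> E. (if l = i then x $ i else 0) / ?n i) = (if l = i then x $ i else 0)"
      using deg[of i] by (simp add: out_degree_def[symmetric])
  qed
  also have "\<dots> = x $ l" by simp
  finally have outflow: "(\<Sum>(i, j)\<in>E. (if l = i then x $ i else 0) / ?n i) = x $ l" .
  have "(\<Sum>(i, j)\<in>E. gossip_matrix E i j *v x) $ l =
     (\<Sum>(i, j)\<in>E. x $ l) + ((\<Sum>(i, j)\<in>E. (if l = j then x $ i else 0) / ?n i)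
       - (\<Sum>(i, j)\<in>E. (if l = i then x $ i else 0) / ?n i))"
    unfolding sum_component sum_subtractf[symmetric] sum.distrib[symmetric]
    by (intro sum.cong refl) (simp add: split_beta gossip_matrix_mult_component diff_divide_distrib)
  then show "(\<Sum>(i, j)\<in>E. gossip_matrix E i j *v x) $ l
      = (real (card E) *\<^sub>R x + (link_matrix E *v x - x)) $ l"
    unfolding inflow outflow by simp
qed

lemma mean_step_eq:
  fixes E :: "('v::finite \<times> 'v) set"
  assumes "\<And>i. out_degree E i \<ge> 1" "E \<noteq> {}"
  shows "mean_step E r x = (1 - r) *\<^sub>R (x + (1 / real (card E)) *\<^sub>R (link_matrix E *v x - x))
    + (r / real CARD('v)) *\<^sub>R 1"
proof -
  have c: "real (card E) \<noteq> 0" using assms by simp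
  have "(\<Sum>e\<in>E. gossip_step E r e x) =
     (1 - r) *\<^sub>R (\<Sum>(i, j)\<in>E. gossip_matrix E i j *v x) + real (card E) *\<^sub>R ((r / real CARD('v)) *\<^sub>R 1)"
    by (simp add: gossip_step_def split_beta sum.distrib scaleR_sum_right sum_constant_scaleR
        del: sum_constant)
  then show ?thesis
    unfolding mean_step_def sum_gossip_matrix_mult[OF assms(1)]
    using c by (simp add: scaleR_add_right scaleR_diff_right)
qed

text \<open>With \<open>A\<close> the link matrix and \<open>u\<close> the uniform vector, the
  PageRank equation reads \<open>(1 - m) (A p - p) = m (p - u)\<close>, since the entries of
  \<open>p\<close> sum to 1. The fixed point equation reads
  \<open>((1 - r) / card E) (A p - p) = r (p - u)\<close>. The choice of \<open>r\<close> makes the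
  second the first divided by \<open>d\<close>.\<close>

lemma pagerank_fixed_by_mean_step:
  fixes E :: "('v::finite \<times> 'v) set"
  assumes deg: "\<And>i. out_degree E i \<ge> 1" and ne: "E \<noteq> {}"
    and m: "0 < m" "m < 1" and pgr: "is_pagerank E m p"
    and r: "r = m / (m - real (card E) * m + real (card E))"
  shows "mean_step E r p = p"
proof (subst vec_eq_iff, intro allI)
  fix l
  let ?c = "real (card E)" and ?n = "real CARD('v)" and ?a = "(link_matrix E *v p) $ l"
  have c: "?c > 0" using ne by (simp add: card_gt_0_iff)
  have "(outer_product 1 1 *v p) = (1 :: real ^ 'v)"
    using pgr by (simp add: is_pagerank_def vec_eq_iff outer_product_def matrix_vector_mult_def)
  then have "(pagerank_matrix E m *v p) $ l = (1 - m) * ?a + m / ?n"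
    by (simp add: pagerank_matrix_def matrix_vector_mult_add_rdistrib scaleR_matrix_vector_assoc[symmetric])
  then have fixed: "(1 - m) * (?a - p $ l) = m * (p $ l - 1 / ?n)"
    using pgr by (simp add: is_pagerank_def algebra_simps)
  \<comment> \<open>The denominator of \<open>r\<close>, arranged so that its positivity is
    visible.\<close>
  define d where "d = m + ?c * (1 - m)"
  have d: "d > 0" using c m by (simp add: d_def add_pos_pos)
  have r': "r = m / d" by (simp add: r d_def algebra_simps)
  have "1 - r = ?c * (1 - m) / d" using d by (simp add: r' d_def field_simps)
  then have "(1 - r) * (1 / ?c * (?a - p $ l)) = (1 - m) * (?a - p $ l) / d"
    using c ne by simp
  also have "\<dots> = r * (p $ l - 1 / ?n)" by (simp add: fixed r')
  finally have "(1 - r) * (1 / ?c * (?a - p $ l)) = r * (p $ l - 1 / ?n)" .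
  then show "mean_step E r p $ l = p $ l"
    unfolding mean_step_eq[OF deg ne] by (simp add: algebra_simps)
qed

text \<open>The linear part \<open>B\<close> of the affine map \<open>mean_step\<close>; being
  linear, it commutes with time averages.\<close>

definition mean_linear :: "('v::finite \<times> 'v) set \<Rightarrow> real \<Rightarrow> real ^ 'v \<Rightarrow> real ^ 'v" where
  "mean_linear E r z =
     (1 / real (card E)) *\<^sub>R (\<Sum>e\<in>E. (1 - r) *\<^sub>R (gossip_matrix E (fst e) (snd e) *v z))"

lemma linear_mean_linear: "linear (mean_linear E r)"
  by (rule linearI) (simp_all add: mean_linear_def matrix_vector_right_distrib scaleR_add_right
      sum.distrib matrix_vector_mult_scaleR scaleR_sum_right mult.commute mult.left_commute)

lemma mean_step_diff: "mean_step E r x - mean_step E r y = mean_linear E r (x - y)"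
  by (simp add: mean_step_def mean_linear_def gossip_step_diff[symmetric] sum_subtractf scaleR_diff_right)

lemma l1_norm_mean_linear_le:
  assumes "\<And>i. out_degree E i \<ge> 1" "0 \<le> r" "r \<le> 1" "E \<noteq> {}"
  shows "l1_norm (mean_linear E r z) \<le> (1 - r) * l1_norm z"
proof -
  have "l1_norm (\<Sum>e\<in>E. (1 - r) *\<^sub>R (gossip_matrix E (fst e) (snd e) *v z)) \<le> (\<Sum>e\<in>E. (1 - r) * l1_norm z)"
    using assms by (intro order_trans[OF l1_norm_sum] sum_mono)
      (auto simp: l1_norm_scaleR intro!: mult_left_mono l1_norm_gossip_matrix_mult_le)
  then show ?thesis
    using assms(4) by (simp add: mean_linear_def l1_norm_scaleR divide_le_eq card_gt_0_iff mult_ac)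
qed

section \<open>Independence of the present edge from the past\<close>

text \<open>Integrates out the present while the past is kept fixed. As the present takes finitely
  many values, splitting by its value and factorizing each term replaces a Fubini argument.\<close>

lemma (in prob_space) expectation_present_past:
  fixes \<theta> :: "nat \<Rightarrow> 'a \<Rightarrow> 'b::finite" and G :: "'b \<Rightarrow> (nat \<Rightarrow> 'b) \<Rightarrow> real"
  assumes indep: "indep_vars (\<lambda>_. count_space UNIV) \<theta> UNIV"
    and G [measurable]: "\<And>e. G e \<in> borel_measurable (PiM {..<n} (\<lambda>_. count_space UNIV))"
    and bound: "\<And>e h. \<bar>G e h\<bar> \<le> C"
  defines "H \<equiv> (\<lambda>\<omega>. restrict (\<lambda>i. \<theta> i \<omega>) {..<n})"
  shows "expectation (\<lambda>\<omega>. G (\<theta> n \<omega>) (H \<omega>)) =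
    expectation (\<lambda>\<omega>. \<Sum>e\<in>UNIV. prob (\<theta> n -` {e} \<inter> space M) * G e (H \<omega>))"
proof -
  have T [measurable]: "\<theta> i \<in> measurable M (count_space UNIV)" for i
    using indep by (auto simp: indep_vars_def)
  have H [measurable]: "H \<in> measurable M (PiM {..<n} (\<lambda>_. count_space UNIV))"
    unfolding H_def by measurable
  have int_G: "integrable M (\<lambda>\<omega>. G e (H \<omega>))" for e
    by (rule integrable_const_bound[where B = C]) (use bound in auto)
  have int_T: "integrable M (\<lambda>\<omega>. indicator {e} (\<theta> n \<omega>) :: real)" for e
    by (rule integrable_const_bound[where B = 1]) (auto simp: indicator_def)
  \<comment> \<open>Independence is available between disjoint blocks of indices, so the present
    enters as the block \<open>{n}\<close>.\<close>
  have "indep_var (PiM {n} (\<lambda>_. count_space UNIV)) (\<lambda>\<omega>. restrict (\<lambda>i. \<theta> i \<omega>) {n})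
      (PiM {..<n} (\<lambda>_. count_space UNIV)) H"
    unfolding H_def by (rule indep_var_restrict[OF indep]) auto
  from indep_var_compose[OF this, of "\<lambda>f. indicator {e} (f n)" borel "G e" borel for e]
  have ind: "indep_var borel (\<lambda>\<omega>. indicator {e} (\<theta> n \<omega>) :: real) borel (\<lambda>\<omega>. G e (H \<omega>))" for e
    by (simp add: comp_def)
  have exp_T: "expectation (\<lambda>\<omega>. indicator {e} (\<theta> n \<omega>) :: real) = prob (\<theta> n -` {e} \<inter> space M)" for e
  proof -
    have "expectation (\<lambda>\<omega>. indicator {e} (\<theta> n \<omega>) :: real)
      = expectation (indicator (\<theta> n -` {e} \<inter> space M))"
      by (intro Bochner_Integration.integral_cong) (auto simp: indicator_def)
    also have "\<dots> = prob (\<theta> n -` {e} \<inter> space M)" by simp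
    finally show ?thesis .
  qed
  have "G (\<theta> n \<omega>) (H \<omega>) = (\<Sum>e\<in>UNIV. indicator {e} (\<theta> n \<omega>) * G e (H \<omega>))" for \<omega>
    by (simp add: indicator_def of_bool_def if_distrib[of "\<lambda>t. t * _"] cong: if_cong)
  then have "expectation (\<lambda>\<omega>. G (\<theta> n \<omega>) (H \<omega>)) =
     expectation (\<lambda>\<omega>. \<Sum>e\<in>UNIV. indicator {e} (\<theta> n \<omega>) * G e (H \<omega>))"
    by presburger
  also have "\<dots> = (\<Sum>e\<in>UNIV. expectation (\<lambda>\<omega>. indicator {e} (\<theta> n \<omega>) * G e (H \<omega>)))"
    by (intro Bochner_Integration.integral_sum indep_var_integrable[OF ind int_T int_G])
  also have "\<dots> = (\<Sum>e\<in>UNIV. prob (\<theta> n -` {e} \<inter> space M) * expectation (\<lambda>\<omega>. G e (H \<omega>)))"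
    using indep_var_lebesgue_integral[OF ind int_T int_G] exp_T by simp
  also have "\<dots> = expectation (\<lambda>\<omega>. \<Sum>e\<in>UNIV. prob (\<theta> n -` {e} \<inter> space M) * G e (H \<omega>))"
    using int_G by (simp add: Bochner_Integration.integral_sum)
  finally show ?thesis .
qed

section \<open>Trajectories and their noise\<close>

text \<open>The state is a function of the edge sequence instead of the sample point, so that it can
  be evaluated on a restricted history and measured on a product space.\<close>

primrec gossip_trajectory ::
  "('v::finite \<times> 'v) set \<Rightarrow> real \<Rightarrow> real ^ 'v \<Rightarrow> (nat \<Rightarrow> 'v \<times> 'v) \<Rightarrow> nat \<Rightarrow> real ^ 'v" where
  "gossip_trajectory E r x0 f 0 = x0"
| "gossip_trajectory E r x0 f (Suc k) = gossip_step E r (f k) (gossip_trajectory E r x0 f k)"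

text \<open>State \<open>k\<close> reads only the edges with index below \<open>k\<close>.\<close>

lemma gossip_trajectory_restrict:
  "k \<le> n \<Longrightarrow> gossip_trajectory E r x0 (restrict f {..<n}) k = gossip_trajectory E r x0 f k"
  by (induction k) auto

lemma borel_measurable_gossip_step [measurable]: "gossip_step E r e \<in> borel_measurable borel"
proof (rule borel_measurable_continuous_onI)
  show "continuous_on UNIV (gossip_step E r e)"
    unfolding gossip_step_def split_beta
    by (intro continuous_intros linear_continuous_on matrix_vector_mul_bounded_linear)
qed

lemma borel_measurable_mean_step [measurable]: "mean_step E r \<in> borel_measurable borel"
  unfolding mean_step_def[abs_def] by measurable

lemma borel_measurable_vec_component [measurable]: "(\<lambda>x :: real ^ 'v::finite. x $ l) \<in> borel_measurable borel"
  by (intro borel_measurable_continuous_onI continuous_intros)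

lemma borel_measurable_gossip_trajectory:
  fixes E :: "('v::finite \<times> 'v) set"
  assumes "k \<le> n"
  shows "(\<lambda>f. gossip_trajectory E r x0 f k) \<in> borel_measurable (PiM {..<n} (\<lambda>_. count_space UNIV))"
  using assms
proof (induction k)
  case 0
  then show ?case by simp
next
  case (Suc k)
  then have [measurable]: "(\<lambda>f. gossip_trajectory E r x0 f k) \<in> borel_measurable (PiM {..<n} (\<lambda>_. count_space UNIV))"
    by simp
  show ?case
    unfolding gossip_trajectory.simps
  \<comment> \<open>The last edge merely selects one of countably many measurable maps of the
    previous state.\<close>
  proof (rule measurable_compose_countable[where g = "\<lambda>f. f k"
        and f = "\<lambda>e f. gossip_step E r e (gossip_trajectory E r x0 f k)"])
    show "(\<lambda>f :: nat \<Rightarrow> 'v \<times> 'v. f k) \<in> measurable (PiM {..<n} (\<lambda>_. count_space UNIV)) (count_space UNIV)"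
      using Suc.prems by (intro measurable_component_singleton) auto
  qed measurable
qed

lemma l1_norm_gossip_trajectory_le:
  assumes "\<And>i. out_degree E i \<ge> 1" "0 \<le> r" "r \<le> 1" "l1_norm x0 \<le> 1"
  shows "l1_norm (gossip_trajectory E r x0 f k) \<le> 1"
  by (induction k) (use assms in \<open>auto intro: l1_norm_gossip_step_le\<close>)

lemma sum_pmf_of_set_gossip_step:
  assumes "E \<noteq> {}"
  shows "(\<Sum>e\<in>UNIV. pmf (pmf_of_set E) e * (gossip_step E r e x - mean_step E r x) $ l) = 0"
proof -
  have "(\<Sum>e\<in>UNIV. pmf (pmf_of_set E) e * (gossip_step E r e x - mean_step E r x) $ l) =
     (\<Sum>e\<in>E. (gossip_step E r e x - mean_step E r x) $ l / real (card E))"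
    using assms by (intro sum.mono_neutral_cong_right) (auto simp: indicator_def)
  also have "\<dots> = ((1 / real (card E)) *\<^sub>R (\<Sum>e\<in>E. gossip_step E r e x) - mean_step E r x) $ l"
    using assms by (simp add: sum_divide_distrib[symmetric] sum_subtractf diff_divide_distrib)
  finally show ?thesis by (simp add: mean_step_def)
qed

text \<open>For \<open>i < j\<close>, the noise at time \<open>i\<close> and the state at time
  \<open>j\<close> depend only on edges before \<open>j\<close>. Given these, the noise at time
  \<open>j\<close> has mean zero, so the two noises are orthogonal.\<close>

lemma (in prob_space) AE_gossip_noise_average_tendsto_0:
  fixes E :: "('v::finite \<times> 'v) set" and \<theta> :: "nat \<Rightarrow> 'a \<Rightarrow> 'v \<times> 'v"
  assumes deg: "\<And>i. out_degree E i \<ge> 1" and ne: "E \<noteq> {}"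
    and r: "0 \<le> r" "r \<le> 1" and x0: "l1_norm x0 \<le> 1"
    and indep: "indep_vars (\<lambda>_. count_space UNIV) \<theta> UNIV"
    and unif: "\<And>k. distr M (count_space UNIV) (\<theta> k) = measure_pmf (pmf_of_set E)"
  defines "y \<equiv> (\<lambda>\<omega>. gossip_trajectory E r x0 (\<lambda>i. \<theta> i \<omega>))"
  shows "AE \<omega> in M. (\<lambda>n. (\<Sum>k<n. (y \<omega> (Suc k) - mean_step E r (y \<omega> k)) $ l) / real n) \<longlonglongrightarrow> 0"
proof (rule AE_average_tendsto_0[where C = 2])
  let ?X = "gossip_trajectory E r x0"
  let ?P = "\<lambda>n. PiM {..<n} (\<lambda>_. count_space UNIV) :: (nat \<Rightarrow> 'v \<times> 'v) measure"
  have T [measurable]: "\<theta> i \<in> measurable M (count_space UNIV)" for i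
    using indep by (auto simp: indep_vars_def)
  have prob_T: "prob (\<theta> k -` {e} \<inter> space M) = pmf (pmf_of_set E) e" for k e
  proof -
    have "measure (distr M (count_space UNIV) (\<theta> k)) {e} = prob (\<theta> k -` {e} \<inter> space M)"
      by (rule measure_distr) auto
    then show ?thesis by (simp add: unif measure_pmf_single)
  qed
  define noise where "noise e z = (gossip_step E r e z - mean_step E r z) $ l" for e z
  have noise_bound: "\<bar>noise e (?X h k)\<bar> \<le> 2" for e h k
  proof -
    have X: "l1_norm (?X h k) \<le> 1" by (rule l1_norm_gossip_trajectory_le[OF deg r x0])
    have "\<bar>gossip_step E r e (?X h k) $ l\<bar> \<le> 1" "\<bar>mean_step E r (?X h k) $ l\<bar> \<le> 1"
      using component_le_l1_norm l1_norm_gossip_step_le[OF deg r X] l1_norm_mean_step_le[OF deg r ne X]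
      by (blast intro: order_trans)+
    then show ?thesis unfolding noise_def by simp
  qed
  have [measurable]: "noise e \<in> borel_measurable borel" for e
    unfolding noise_def[abs_def] by measurable
  have y_noise: "(y \<omega> (Suc k) - mean_step E r (y \<omega> k)) $ l = noise (\<theta> k \<omega>) (?X (\<lambda>i. \<theta> i \<omega>) k)" for \<omega> k
    by (simp add: y_def noise_def)
  have H [measurable]: "(\<lambda>\<omega>. restrict (\<lambda>i. \<theta> i \<omega>) {..<n}) \<in> measurable M (?P n)" for n
    by measurable
  show "random_variable borel (\<lambda>\<omega>. (y \<omega> (Suc k) - mean_step E r (y \<omega> k)) $ l)" for k
  proof -
    have "random_variable borel (\<lambda>\<omega>. y \<omega> j)" for j
      using measurable_compose[OF H borel_measurable_gossip_trajectory[OF order_refl]]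
      by (simp add: gossip_trajectory_restrict y_def)
    note [measurable] = this
    show ?thesis by measurable
  qed
  show "\<bar>(y \<omega> (Suc k) - mean_step E r (y \<omega> k)) $ l\<bar> \<le> 2" for k \<omega>
    unfolding y_noise by (rule noise_bound)
  show "expectation (\<lambda>\<omega>. (y \<omega> (Suc i) - mean_step E r (y \<omega> i)) $ l
      * (y \<omega> (Suc j) - mean_step E r (y \<omega> j)) $ l) = 0" if ij: "i < j" for i j
  proof -
    \<comment> \<open>The argument \<open>e\<close> stands for the edge at time \<open>j\<close> and
      \<open>h\<close> for the history before it; \<open>e\<close> enters the last factor
      only.\<close>
    define G where "G e h = noise (h i) (?X h i) * noise e (?X h j)" for e h
    have [measurable]: "(\<lambda>h. ?X h k) \<in> borel_measurable (?P j)" if "k \<le> j" for k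
      using that by (rule borel_measurable_gossip_trajectory)
    have "(\<lambda>h. noise (h i) (?X h i)) \<in> borel_measurable (?P j)"
    proof (rule measurable_compose_countable[where g = "\<lambda>h. h i" and f = "\<lambda>e h. noise e (?X h i)"])
      show "(\<lambda>h. h i) \<in> measurable (?P j) (count_space UNIV)"
        using ij by (intro measurable_component_singleton) auto
    qed (use ij in \<open>measurable, simp\<close>)
    note [measurable] = this
    have G: "G e \<in> borel_measurable (?P j)" for e
      unfolding G_def by measurable
    have G_bound: "\<bar>G e h\<bar> \<le> 2 * 2" for e h
      unfolding G_def abs_mult by (intro mult_mono noise_bound) auto
    have weighted_zero: "(\<Sum>e\<in>UNIV. pmf (pmf_of_set E) e * G e h) = 0" for h
    proof -
      have "(\<Sum>e\<in>UNIV. pmf (pmf_of_set E) e * G e h) =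
        noise (h i) (?X h i) * (\<Sum>e\<in>UNIV. pmf (pmf_of_set E) e * noise e (?X h j))"
        unfolding G_def sum_distrib_left by (simp add: mult_ac)
      then show ?thesis
        unfolding noise_def sum_pmf_of_set_gossip_step[OF ne] by simp
    qed
    have "expectation (\<lambda>\<omega>. (y \<omega> (Suc i) - mean_step E r (y \<omega> i)) $ l
        * (y \<omega> (Suc j) - mean_step E r (y \<omega> j)) $ l)
      = expectation (\<lambda>\<omega>. G (\<theta> j \<omega>) (restrict (\<lambda>i. \<theta> i \<omega>) {..<j}))"
      unfolding y_noise G_def using ij by (simp add: gossip_trajectory_restrict)
    also have "\<dots> = expectation (\<lambda>\<omega>. \<Sum>e\<in>UNIV. pmf (pmf_of_set E) e * G e (restrict (\<lambda>i. \<theta> i \<omega>) {..<j}))"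
      unfolding prob_T[of j, symmetric] by (rule expectation_present_past[OF indep G G_bound])
    also have "\<dots> = 0" by (simp only: weighted_zero Bochner_Integration.integral_zero)
    finally show ?thesis .
  qed
qed

section \<open>The deterministic averaging argument along one trajectory\<close>

lemma average_tendsto_fixed_point:
  fixes E :: "('v::finite \<times> 'v) set"
  assumes deg: "\<And>i. out_degree E i \<ge> 1" and ne: "E \<noteq> {}"
    and r: "0 < r" "r \<le> 1" and bound: "\<And>k. l1_norm (y k) \<le> 1"
    and fixed: "mean_step E r p = p"
    and noise: "\<And>l. (\<lambda>n. (\<Sum>k<n. (y (Suc k) - mean_step E r (y k)) $ l) / real n) \<longlonglongrightarrow> 0"
  shows "(\<lambda>n. (1 / real n) *\<^sub>R (\<Sum>k<n. y (Suc k))) \<longlonglongrightarrow> p"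
proof -
  define D where "D n = (1 / real n) *\<^sub>R (\<Sum>k<n. y (Suc k) - p)" for n
  \<comment> \<open>The linear recursion expresses the average \<open>D\<close> through this one,
    taken one time step earlier. Telescoping shows that they differ by
    \<open>(y 0 - y n) / n\<close>.\<close>
  define W where "W n = (1 / real n) *\<^sub>R (\<Sum>k<n. y k - p)" for n
  define S where "S n = (1 / real n) *\<^sub>R (\<Sum>k<n. y (Suc k) - mean_step E r (y k))" for n
  have "(\<lambda>n. S n $ l) \<longlonglongrightarrow> 0" for l
    using noise[of l] by (simp add: S_def)
  then have S_lim: "(\<lambda>n. l1_norm (S n)) \<longlonglongrightarrow> 0"
    unfolding l1_norm_def by (intro tendsto_null_sum tendsto_rabs_zero)
  \<comment> \<open>This includes \<open>n = 0\<close>, where both sides vanish since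
    \<open>2 / 0 = 0\<close>.\<close>
  have D_bound: "l1_norm (D n) \<le> (2 / real n + l1_norm (S n)) / r" for n
  proof -
    have "y (Suc k) - p = mean_linear E r (y k - p) + (y (Suc k) - mean_step E r (y k))" for k
      unfolding mean_step_diff[symmetric] fixed by simp
    then have "(\<Sum>k<n. y (Suc k) - p) =
        (\<Sum>k<n. mean_linear E r (y k - p)) + (\<Sum>k<n. y (Suc k) - mean_step E r (y k))"
      unfolding sum.distrib[symmetric] by (intro sum.cong refl)
    then have "D n = mean_linear E r (W n) + S n"
      unfolding D_def W_def S_def linear_scale[OF linear_mean_linear] linear_sum[OF linear_mean_linear]
      by (simp only: scaleR_add_right)
    then have D: "l1_norm (D n) \<le> (1 - r) * l1_norm (W n) + l1_norm (S n)"
      using l1_norm_triangle[of "mean_linear E r (W n)" "S n"] l1_norm_mean_linear_le[OF deg _ _ ne, of r "W n"] r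
      by simp
    have "(\<Sum>k<n. y k - p) = (\<Sum>k<n. y (Suc k) - p) + (y 0 - y n)"
      by (induction n) (auto simp: algebra_simps)
    then have W: "W n = D n + (1 / real n) *\<^sub>R (y 0 - y n)"
      by (simp add: W_def D_def scaleR_add_right)
    have "l1_norm (y 0 - y n) \<le> 2"
      using l1_norm_triangle[of "y 0" "(-1) *\<^sub>R y n"] bound[of 0] bound[of n]
      unfolding l1_norm_scaleR by simp
    then have "l1_norm (W n) \<le> l1_norm (D n) + 2 / real n"
      unfolding W by (intro order_trans[OF l1_norm_triangle] add_left_mono)
        (simp add: l1_norm_scaleR divide_right_mono)
    then have "(1 - r) * l1_norm (W n) \<le> (1 - r) * l1_norm (D n) + (1 - r) * (2 / real n)"
      using r unfolding distrib_left[symmetric] by (intro mult_left_mono) auto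
    moreover have "(1 - r) * (2 / real n) \<le> 1 * (2 / real n)"
      using r by (intro mult_right_mono) auto
    \<comment> \<open>The contraction lets \<open>(1 - r) * l1_norm (D n)\<close> be absorbed on the
      left, leaving the factor \<open>r\<close>.\<close>
    ultimately have "r * l1_norm (D n) \<le> 2 / real n + l1_norm (S n)"
      using D by (simp add: algebra_simps)
    then show ?thesis using r by (simp add: field_simps)
  qed
  have "(\<lambda>n. (2 / real n + l1_norm (S n)) / r) \<longlonglongrightarrow> (0 + 0) / r"
    using r by (intro tendsto_intros S_lim lim_const_over_n) auto
  then have "(\<lambda>n. (2 / real n + l1_norm (S n)) / r) \<longlonglongrightarrow> 0" by simp
  then have "(\<lambda>n. D n $ l) \<longlonglongrightarrow> 0" for l
    by (rule Lim_null_comparison[rotated])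
       (use component_le_l1_norm D_bound in \<open>auto intro!: always_eventually intro: order_trans\<close>)
  then have "D \<longlonglongrightarrow> 0" by (intro vec_tendstoI) simp
  then have "(\<lambda>n. D n + p) \<longlonglongrightarrow> 0 + p" by (intro tendsto_intros)
  moreover have "\<forall>\<^sub>F n in sequentially. D n + p = (1 / real n) *\<^sub>R (\<Sum>k<n. y (Suc k))"
    using eventually_gt_at_top[of 0]
    by eventually_elim (simp add: D_def sum_subtractf scaleR_diff_right sum_constant_scaleR del: sum_constant)
  ultimately show ?thesis by (simp add: tendsto_cong)
qed

theorem theorem3:
  fixes E :: "('v::finite \<times> 'v) set"
    and m r :: real
    and x_pgr x0 :: "real ^ 'v"
    and M :: "'a measure"
    and \<theta> :: "nat \<Rightarrow> 'a \<Rightarrow> 'v \<times> 'v"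
    and x x_avg :: "nat \<Rightarrow> 'a \<Rightarrow> real ^ 'v"
  assumes "CARD('v) > 2"
    and "\<And>i. out_degree E i \<ge> 1"
    and "0 < m" and "m < 1"
    and "is_pagerank E m x_pgr"
    and "prob_space M"
    and "prob_space.indep_vars M (\<lambda>_. count_space UNIV) \<theta> UNIV"
    and "\<And>k. distr M (count_space UNIV) (\<theta> k) = measure_pmf (pmf_of_set E)"
    and "r = m / (m - real (card E) * m + real (card E))"
    and "stochastic_vector x0"
    and "\<And>\<omega>. \<omega> \<in> space M \<Longrightarrow> x 0 \<omega> = x0"
    and "\<And>k \<omega>. \<omega> \<in> space M \<Longrightarrow> x (Suc k) \<omega> = gossip_step E r (\<theta> k \<omega>) (x k \<omega>)"
    and "\<And>k \<omega> l. \<omega> \<in> space M \<Longrightarrow>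
           x_avg (Suc k) \<omega> $ l = (real k * x_avg k \<omega> $ l + x (Suc k) \<omega> $ l) / real (k + 1)"
  shows "AE \<omega> in M. (\<lambda>k. x_avg k \<omega>) \<longlonglongrightarrow> x_pgr"
proof -
  interpret prob_space M by fact
  note deg = assms(2) and m = assms(3,4)
  have ne: "E \<noteq> {}"
    using deg[of undefined] by (auto simp: out_degree_def)
  \<comment> \<open>Makes the denominator of \<open>r\<close> exceed \<open>m\<close>.\<close>
  have "real (card E) * m < real (card E)" using m ne by (simp add: card_gt_0_iff)
  then have r: "0 < r" "r \<le> 1" using m by (auto simp: assms(9) divide_le_eq)
  have x0: "l1_norm x0 \<le> 1"
    using assms(10) by (simp add: l1_norm_def stochastic_vector_def)
  define y where "y \<omega> = gossip_trajectory E r x0 (\<lambda>i. \<theta> i \<omega>)" for \<omega>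
  have x_eq: "x k \<omega> = y \<omega> k" if "\<omega> \<in> space M" for k \<omega>
    using assms(11,12)[OF that] by (induction k) (simp_all add: y_def)
  have avg: "x_avg n \<omega> = (1 / real n) *\<^sub>R (\<Sum>k<n. y \<omega> (Suc k))" if "\<omega> \<in> space M" "n > 0" for n \<omega>
  proof -
    \<comment> \<open>In multiplied form the recursion gives \<open>x_avg 0\<close> the weight
      \<open>0\<close>, so the induction starts whatever that value is.\<close>
    have "real n * x_avg n \<omega> $ l = (\<Sum>k<n. y \<omega> (Suc k) $ l)" for l
      by (induction n) (simp_all add: assms(13)[OF that(1)] x_eq[OF that(1)])
    then show ?thesis using that(2) by (simp add: vec_eq_iff field_simps)
  qed
  \<comment> \<open>Finitely many coordinates share one null set, outside which the rest is
    deterministic.\<close>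
  have "AE \<omega> in M. \<forall>l. (\<lambda>n. (\<Sum>k<n. (y \<omega> (Suc k) - mean_step E r (y \<omega> k)) $ l) / real n) \<longlonglongrightarrow> 0"
    unfolding AE_all_countable y_def
    using r by (intro allI AE_gossip_noise_average_tendsto_0[OF deg ne _ _ x0 assms(7,8)]) auto
  then show ?thesis
  proof (rule AE_mp, intro AE_I2 impI)
    fix \<omega> assume \<omega>: "\<omega> \<in> space M"
      and noise: "\<forall>l. (\<lambda>n. (\<Sum>k<n. (y \<omega> (Suc k) - mean_step E r (y \<omega> k)) $ l) / real n) \<longlonglongrightarrow> 0"
    have "l1_norm (y \<omega> k) \<le> 1" for k
      unfolding y_def using r by (intro l1_norm_gossip_trajectory_le[OF deg _ _ x0]) auto
    then have "(\<lambda>n. (1 / real n) *\<^sub>R (\<Sum>k<n. y \<omega> (Suc k))) \<longlonglongrightarrow> x_pgr"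
      using noise by (intro average_tendsto_fixed_point[OF deg ne r]
          pagerank_fixed_by_mean_step[OF deg ne m assms(5,9)]) auto
    moreover have "\<forall>\<^sub>F n in sequentially. x_avg n \<omega> = (1 / real n) *\<^sub>R (\<Sum>k<n. y \<omega> (Suc k))"
      using eventually_gt_at_top[of 0] by eventually_elim (rule avg[OF \<omega>])
    ultimately show "(\<lambda>k. x_avg k \<omega>) \<longlonglongrightarrow> x_pgr" by (simp add: tendsto_cong)
  qed
qed

end
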